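(* Let $\mathcal{R}(f)$ be of the form $\mathcal{R}(f)=\int_{\Omega}\Phi\big(\mathcal{H}f(\mathbf{r})\big)\,\mathrm{d}\mathbf{r}$, where $\Omega\subset\mathbb{R}^2$, $\mathcal{H}$ is the Hessian operator and $f$ is twice continuously differentiable, and let $p\ge1$. Then $\mathcal{R}(f)$ is a translation-, rotation-, and scale-invariant functional if and only if the potential function $\Phi:\mathbb{R}^{2\times2}\to\mathbb{R}$ is of the form $$\Phi\big(\mathcal{H}f(\mathbf{r})\big)=\Phi_0\!\left(\frac{\boldsymbol{\lambda}_f(\mathbf{r})}{\|\mathcal{H}f(\mathbf{r})\|_{\mathcal{S}_p}}\right)\|\mathcal{H}f(\mathbf{r})\|_{\mathcal{S}_p}^{\nu},$$ where $\nu\in\mathbb{R}$ and $\Phi_0$ is a zero-degree homogeneous function of the Hessian eigenvalues $\boldsymbol{\lambda}_f(\mathbf{r})$.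
   Context: Here $f$ is an image, i.e. a real-valued function of $\mathbf{r}=(r_1,r_2)\in\mathbb{R}^2$. Its Hessian at $\mathbf{r}$ is the symmetric matrix $\mathcal{H}f(\mathbf{r})=\begin{pmatrix} f_{r_1r_1}(\mathbf{r}) & f_{r_1r_2}(\mathbf{r})\\ f_{r_2r_1}(\mathbf{r}) & f_{r_2r_2}(\mathbf{r})\end{pmatrix}$ with $f_{r_ir_j}=\partial^2 f/\partial r_i\partial r_j$, and $\boldsymbol{\lambda}_f(\mathbf{r})\in\mathbb{R}^2$ is the vector of its two eigenvalues. The Schatten norm of order $p\ge1$ of a matrix $\mathbf{X}$, $\|\mathbf{X}\|_{\mathcal{S}_p}$, is the $\ell_p$ norm of the vector of singular values of $\mathbf{X}$; for the Hessian, $\|\mathcal{H}f(\mathbf{r})\|_{\mathcal{S}_p}=\|\boldsymbol{\lambda}_f(\mathbf{r})\|_p$. A function $\Phi_0$ is zero-degree homogeneous if $\Phi_0(t\mathbf{x})=\Phi_0(\mathbf{x})$ for all $t>0$. The potential $\Phi$ is a fixed function, not depending on $f$. The invariances are required for all twice continuously differentiable $f$, and refer to changes of the coordinate system, the domain of integration being transformed together with the coordinates. Writing $\mathcal{R}_D(f)=\int_D\Phi(\mathcal{H}f(\mathbf{r}))\,\mathrm{d}\mathbf{r}$ for a domain $D$, so that $\mathcal{R}=\mathcal{R}_\Omega$, they mean the following. Translation invariance: $\mathcal{R}_{\Omega-\mathbf{s}}(f(\cdot+\mathbf{s}))=\mathcal{R}_\Omega(f)$ for every $\mathbf{s}\in\mathbb{R}^2$.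 Rotation invariance: $\mathcal{R}_{\mathbf{R}_\theta^{T}\Omega}(f(\mathbf{R}_\theta\,\cdot))=\mathcal{R}_\Omega(f)$ for every $2\times2$ rotation matrix $\mathbf{R}_\theta$, where $\mathbf{R}_\theta^{T}\Omega=\{\mathbf{R}_\theta^{T}\mathbf{r}:\mathbf{r}\in\Omega\}$. Scale invariance (up to a multiplicative factor): there is an exponent $\mu\in\mathbb{R}$ such that $\mathcal{R}_{\Omega/a}(f(a\,\cdot))=a^{\mu}\,\mathcal{R}_\Omega(f)$ for every $a>0$, where $\Omega/a=\{\mathbf{r}/a:\mathbf{r}\in\Omega\}$.
   Formalization: Ω is assumed Lebesgue measurable with 0 < |Ω| < ∞; for null Ω every Φ is invariant, and for |Ω| = ∞ the potential 1+‖·‖ is a counterexample. At a zero Hessian the quotient is read as 0, with 0^0 = 1 and 0^ν = 0 for ν ≠ 0. *)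

theory Defs
  imports "HOL-Analysis.Analysis"
begin

definition partial_deriv :: "2 \<Rightarrow> (real ^ 2 \<Rightarrow> real) \<Rightarrow> real ^ 2 \<Rightarrow> real" where
  "partial_deriv i f r = frechet_derivative f (at r) (axis i 1)"

definition hessian :: "(real ^ 2 \<Rightarrow> real) \<Rightarrow> real ^ 2 \<Rightarrow> real ^ 2 ^ 2" where
  "hessian f r = (\<chi> i j. partial_deriv i (partial_deriv j f) r)"

definition twice_cont_diff :: "(real ^ 2 \<Rightarrow> real) \<Rightarrow> bool" where
  "twice_cont_diff f \<longleftrightarrow>
     f differentiable_on UNIV \<and>
     (\<forall>i. partial_deriv i f differentiable_on UNIV) \<and>
     (\<forall>i j. continuous_on UNIV (partial_deriv i (partial_deriv j f)))"

text \<open>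
  The eigenvalues are the roots of the characteristic polynomial, counted with multiplicity and
  listed in decreasing order. The description is meaningful exactly when both roots are real, as
  is the case for symmetric matrices.
\<close>

definition eigenvalues :: "real ^ 2 ^ 2 \<Rightarrow> real ^ 2" where
  "eigenvalues A = (THE l. l $ 1 \<ge> l $ 2 \<and>
     (\<forall>x. det (mat x - A) = (x - l $ 1) * (x - l $ 2)))"

lemma eigenvalues_eqI:
  assumes "l $ 1 \<ge> l $ 2" "\<And>x. det (mat x - A) = (x - l $ 1) * (x - l $ 2)"
  shows "eigenvalues A = l"
  unfolding eigenvalues_def
proof (rule the_equality)
  fix m :: "real ^ 2"
  assume m: "m $ 1 \<ge> m $ 2 \<and> (\<forall>x. det (mat x - A) = (x - m $ 1) * (x - m $ 2))"
  have eq: "(x - m $ 1) * (x - m $ 2) = (x - l $ 1) * (x - l $ 2)" for x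
    by (rule trans[OF spec[OF conjunct2[OF m], symmetric] assms(2)])
  have roots: "z = m $ 1 \<or> z = m $ 2 \<longleftrightarrow> z = l $ 1 \<or> z = l $ 2" for z
  proof -
    have "(z - m $ 1) * (z - m $ 2) = 0 \<longleftrightarrow> (z - l $ 1) * (z - l $ 2) = 0"
      by (simp only: eq)
    then show ?thesis
      by (simp only: mult_eq_0_iff right_minus_eq)
  qed
  have ord: "m $ 2 \<le> m $ 1"
    using m by (rule conjunct1)
  have "m $ 1 = l $ 1"
    using roots[of "m $ 1"] roots[of "l $ 1"] ord assms(1) by linarith
  moreover have "m $ 2 = l $ 2"
    using roots[of "m $ 2"] roots[of "l $ 2"] ord assms(1) by linarith
  ultimately show "m = l"
    by (simp add: vec_eq_iff forall_2)
qed (use assms in blast)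

lemma eigenvalues_symmetric:
  assumes "transpose A = A"
  shows "eigenvalues A $ 1 \<ge> eigenvalues A $ 2"
    and "det (mat x - A) = (x - eigenvalues A $ 1) * (x - eigenvalues A $ 2)"
proof -
  have sym: "A $ 2 $ 1 = A $ 1 $ 2"
  proof -
    have "transpose A $ 1 $ 2 = A $ 2 $ 1"
      by (simp add: transpose_def)
    then show ?thesis
      using assms by simp
  qed
  define d where "d = sqrt ((A $ 1 $ 1 - A $ 2 $ 2)\<^sup>2 + 4 * (A $ 1 $ 2)\<^sup>2)"
  have d: "d \<ge> 0" "d * d = (A $ 1 $ 1 - A $ 2 $ 2)\<^sup>2 + 4 * (A $ 1 $ 2)\<^sup>2"
    by (simp_all add: d_def)
  define l :: "real ^ 2" where
    "l = vector [(A $ 1 $ 1 + A $ 2 $ 2 + d) / 2, (A $ 1 $ 1 + A $ 2 $ 2 - d) / 2]"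
  have ord: "l $ 1 \<ge> l $ 2"
    using d(1) by (simp add: l_def)
  have det: "det (mat y - A) = (y - l $ 1) * (y - l $ 2)" for y
  proof -
    have l: "2 * l $ 1 = A $ 1 $ 1 + A $ 2 $ 2 + d" "2 * l $ 2 = A $ 1 $ 1 + A $ 2 $ 2 - d"
      by (simp_all add: l_def)
    have "4 * ((y - l $ 1) * (y - l $ 2)) = (2 * y - 2 * l $ 1) * (2 * y - 2 * l $ 2)"
      by (simp add: algebra_simps)
    also have "\<dots> =
        (2 * y - (A $ 1 $ 1 + A $ 2 $ 2)) * (2 * y - (A $ 1 $ 1 + A $ 2 $ 2)) - d * d"
      unfolding l by (simp add: algebra_simps)
    also have "\<dots> = 4 * ((y - A $ 1 $ 1) * (y - A $ 2 $ 2) - A $ 1 $ 2 * A $ 1 $ 2)"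
      unfolding d(2) by (simp add: power2_eq_square algebra_simps)
    also have "(y - A $ 1 $ 1) * (y - A $ 2 $ 2) - A $ 1 $ 2 * A $ 1 $ 2 = det (mat y - A)"
      by (simp add: det_2 mat_def sym)
    finally show ?thesis
      by simp
  qed
  have "eigenvalues A = l"
    using ord det by (rule eigenvalues_eqI)
  then show "eigenvalues A $ 1 \<ge> eigenvalues A $ 2"
    and "det (mat x - A) = (x - eigenvalues A $ 1) * (x - eigenvalues A $ 2)"
    using ord det by simp_all
qed

definition singular_values :: "real ^ 2 ^ 2 \<Rightarrow> real ^ 2" where
  "singular_values A = (\<chi> i. sqrt (eigenvalues (transpose A ** A) $ i))"

definition lp_norm :: "ereal \<Rightarrow> real ^ 'n \<Rightarrow> real" where
  "lp_norm p x = (if p = \<infinity> then infnorm x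
     else (\<Sum>i\<in>UNIV. \<bar>x $ i\<bar> powr real_of_ereal p) powr (1 / real_of_ereal p))"

definition schatten_norm :: "ereal \<Rightarrow> real ^ 2 ^ 2 \<Rightarrow> real" where
  "schatten_norm p A = lp_norm p (singular_values A)"

text \<open>
  Real powers of nonnegative reals with the convention that the zeroth power of 0 is 1, whereas
  \<open>0 powr 0 = 0\<close>. Any other power of 0, negative ones included, is 0.
  This fixes the value of the potential at a vanishing Hessian, where the eigenvalue vector divided
  by its norm is \<open>0 /\<^sub>R 0 = 0\<close>: homogeneity forces the potential to vanish there unless \<open>\<nu> = 0\<close>,
  in which case its value at 0 is unrestricted.
\<close>

definition rpow :: "real \<Rightarrow> real \<Rightarrow> real" where
  "rpow x \<nu> = (if \<nu> = 0 then 1 else x powr \<nu>)"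

definition functional_defined :: "(real ^ 2 ^ 2 \<Rightarrow> real) \<Rightarrow> (real ^ 2) set \<Rightarrow> (real ^ 2 \<Rightarrow> real) \<Rightarrow> bool"
  where "functional_defined \<Phi> D f \<longleftrightarrow> set_integrable lebesgue D (\<lambda>r. \<Phi> (hessian f r))"

definition functional :: "(real ^ 2 ^ 2 \<Rightarrow> real) \<Rightarrow> (real ^ 2) set \<Rightarrow> (real ^ 2 \<Rightarrow> real) \<Rightarrow> real"
  where "functional \<Phi> D f = set_lebesgue_integral lebesgue D (\<lambda>r. \<Phi> (hessian f r))"

text \<open>
  The potential is an arbitrary function, so the integral need not exist for every \<open>f\<close>. Each
  invariance therefore says that one side exists if and only if the other does, and that then the
  values agree; if neither exists, the equation reads \<open>0 = 0\<close>.
\<close>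

definition translation_invariant :: "(real ^ 2 ^ 2 \<Rightarrow> real) \<Rightarrow> (real ^ 2) set \<Rightarrow> bool" where
  "translation_invariant \<Phi> \<Omega> \<longleftrightarrow> (\<forall>f s. twice_cont_diff f \<longrightarrow>
     (functional_defined \<Phi> ((\<lambda>r. r - s) ` \<Omega>) (\<lambda>r. f (r + s)) \<longleftrightarrow> functional_defined \<Phi> \<Omega> f) \<and>
     functional \<Phi> ((\<lambda>r. r - s) ` \<Omega>) (\<lambda>r. f (r + s)) = functional \<Phi> \<Omega> f)"

definition rotation_invariant :: "(real ^ 2 ^ 2 \<Rightarrow> real) \<Rightarrow> (real ^ 2) set \<Rightarrow> bool" where
  "rotation_invariant \<Phi> \<Omega> \<longleftrightarrow> (\<forall>f R. twice_cont_diff f \<longrightarrow> rotation_matrix R \<longrightarrow>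
     (functional_defined \<Phi> ((\<lambda>r. transpose R *v r) ` \<Omega>) (\<lambda>r. f (R *v r)) \<longleftrightarrow>
        functional_defined \<Phi> \<Omega> f) \<and>
     functional \<Phi> ((\<lambda>r. transpose R *v r) ` \<Omega>) (\<lambda>r. f (R *v r)) = functional \<Phi> \<Omega> f)"

definition scale_invariant :: "(real ^ 2 ^ 2 \<Rightarrow> real) \<Rightarrow> (real ^ 2) set \<Rightarrow> bool" where
  "scale_invariant \<Phi> \<Omega> \<longleftrightarrow> (\<exists>\<mu>::real. \<forall>f a. twice_cont_diff f \<longrightarrow> a > 0 \<longrightarrow>
     (functional_defined \<Phi> ((\<lambda>r. r /\<^sub>R a) ` \<Omega>) (\<lambda>r. f (a *\<^sub>R r)) \<longleftrightarrow> functional_defined \<Phi> \<Omega> f) \<and>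
     functional \<Phi> ((\<lambda>r. r /\<^sub>R a) ` \<Omega>) (\<lambda>r. f (a *\<^sub>R r)) = a powr \<mu> * functional \<Phi> \<Omega> f)"

definition zero_degree_homogeneous :: "(real ^ 2 \<Rightarrow> real) \<Rightarrow> bool" where
  "zero_degree_homogeneous \<Phi>\<^sub>0 \<longleftrightarrow> (\<forall>t x. t > 0 \<longrightarrow> \<Phi>\<^sub>0 (t *\<^sub>R x) = \<Phi>\<^sub>0 x)"

end

theory Submission
  imports Defs
begin

text \<open>
  A quadratic form \<open>f(r) = (r \<bullet> A r) / 2\<close> has the constant Hessian \<open>A\<close>, so its functional is the
  area of the domain times \<open>\<Phi> A\<close>. Testing the invariances on such \<open>f\<close> alone gives
  \<open>\<Phi> (R\<^sup>T A R) = \<Phi> A\<close> for rotations \<open>R\<close> and \<open>\<Phi> (c A) = c\<^sup>\<nu> \<Phi> A\<close> for \<open>c > 0\<close>, with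
  \<open>\<nu> = (\<mu> + 2) / 2\<close>. By the spectral theorem the potential is then determined by the normalised
  eigenvalues. Conversely, an affine change of coordinates with linear part \<open>M\<close> turns the Hessian
  \<open>H\<close> into \<open>M\<^sup>T H M\<close>, and the change of variables formula, valid for arbitrary integrands, reduces
  each invariance to the corresponding property of \<open>\<Phi>\<close> on symmetric matrices.
\<close>

subsection \<open>Affine changes of variables\<close>

text \<open>The change of variables theorem is an equivalence that covers absolute integrability
  together with the value of the integral, so it applies to an arbitrary \<open>F\<close>. The
  Jacobian factor is the nonzero constant \<open>\<bar>det N\<bar>\<close>, which affects
  integrability on neither side and comes out of the integral.\<close>

lemma set_integral_affine_image:
  fixes N :: "real ^ 'n :: {finite,wellorder} ^ 'n :: _" and F :: "real ^ 'n :: _ \<Rightarrow> real"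
  assumes \<Omega>: "\<Omega> \<in> sets lebesgue" and N: "invertible N" and h: "\<And>r. h r = N *v (r - s)"
  shows "set_integrable lebesgue (h ` \<Omega>) F \<longleftrightarrow> set_integrable lebesgue \<Omega> (\<lambda>r. F (h r))"
    and "set_lebesgue_integral lebesgue (h ` \<Omega>) F =
      \<bar>det N\<bar> * set_lebesgue_integral lebesgue \<Omega> (\<lambda>r. F (h r))"
proof -
  have det: "det N \<noteq> 0"
    using N by (simp add: invertible_det_nz)
  have der: "(h has_derivative (\<lambda>x. N *v x)) (at x within \<Omega>)" for x
  proof -
    have "h = (\<lambda>r. N *v (r - s))"
      using h by blast
    moreover have "((\<lambda>r. N *v (r - s)) has_derivative (\<lambda>x. N *v x)) (at x within \<Omega>)"
      by (rule bounded_linear.has_derivative[OF matrix_vector_mul_bounded_linear])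
        (auto intro!: derivative_eq_intros)
    ultimately show ?thesis
      by simp
  qed
  have inj: "inj_on h \<Omega>"
  proof (rule inj_onI)
    fix x y
    assume "h x = h y"
    then have "x - s = y - s"
      unfolding h by (rule injD[OF inj_matrix_vector_mult[OF N]])
    then show "x = y"
      by simp
  qed
  have cv: "set_integrable lebesgue \<Omega> (\<lambda>r. \<bar>det N\<bar> * F (h r)) \<and>
      integral \<Omega> (\<lambda>r. \<bar>det N\<bar> * F (h r)) = b \<longleftrightarrow>
      set_integrable lebesgue (h ` \<Omega>) F \<and> integral (h ` \<Omega>) F = b" for b
  proof -
    \<comment> \<open>The theorem treats vector-valued integrands; the scalar \<open>F\<close> is
      carried by the one-dimensional space \<open>real ^ 1\<close>.\<close>
    have "(\<lambda>r. \<bar>det (matrix ((*v) N))\<bar> *\<^sub>R (vec (F (h r)) :: real ^ 1)) absolutely_integrable_on \<Omega> \<and>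
        integral \<Omega> (\<lambda>r. \<bar>det (matrix ((*v) N))\<bar> *\<^sub>R (vec (F (h r)) :: real ^ 1)) = vec b \<longleftrightarrow>
        (\<lambda>r. vec (F r) :: real ^ 1) absolutely_integrable_on h ` \<Omega> \<and>
        integral (h ` \<Omega>) (\<lambda>r. vec (F r) :: real ^ 1) = vec b"
      by (rule has_absolute_integral_change_of_variables[OF \<Omega> der inj])
    then show ?thesis
      by (simp add: absolutely_integrable_on_1_iff integral_on_1_eq vec_eq_iff)
  qed
  show iff: "set_integrable lebesgue (h ` \<Omega>) F \<longleftrightarrow> set_integrable lebesgue \<Omega> (\<lambda>r. F (h r))"
    using cv det by auto
  show "set_lebesgue_integral lebesgue (h ` \<Omega>) F =
      \<bar>det N\<bar> * set_lebesgue_integral lebesgue \<Omega> (\<lambda>r. F (h r))"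
  proof (cases "set_integrable lebesgue \<Omega> (\<lambda>r. F (h r))")
    case True
    then have "integral (h ` \<Omega>) F = integral \<Omega> (\<lambda>r. \<bar>det N\<bar> * F (h r))"
      using cv[of "integral \<Omega> (\<lambda>r. \<bar>det N\<bar> * F (h r))"] det by auto
    then show ?thesis
      using True iff by (simp add: set_lebesgue_integral_eq_integral)
  next
    \<comment> \<open>Without integrability both Lebesgue integrals take the default value
      0.\<close>
    case False
    then show ?thesis
      using iff by (simp add: set_integrable_def set_lebesgue_integral_def not_integrable_integral_eq)
  qed
qed

section \<open>Chain rule for partial derivatives and Hessians\<close>

lemma has_derivative_partial_deriv:
  assumes "f differentiable (at r)"
  shows "(f has_derivative (\<lambda>h. \<Sum>i\<in>UNIV. h $ i * partial_deriv i f r)) (at r)"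
proof -
  have "(f has_derivative frechet_derivative f (at r)) (at r)"
    using assms by (simp add: frechet_derivative_works)
  moreover have "frechet_derivative f (at r) = (\<lambda>h. \<Sum>i\<in>UNIV. h $ i * partial_deriv i f r)"
  proof
    fix h
    interpret linear "frechet_derivative f (at r)"
      using assms by (rule linear_frechet_derivative)
    have "frechet_derivative f (at r) h =
        frechet_derivative f (at r) (\<Sum>i\<in>UNIV. h $ i *\<^sub>R axis i 1)"
      using basis_expansion[of h] by (simp add: scalar_mult_eq_scaleR)
    then show "frechet_derivative f (at r) h = (\<Sum>i\<in>UNIV. h $ i * partial_deriv i f r)"
      by (simp add: sum scale partial_deriv_def)
  qed
  ultimately show ?thesis
    by (rule has_derivative_eq_rhs)
qed

lemma partial_deriv_eqI:
  "(f has_derivative f') (at r) \<Longrightarrow> partial_deriv i f r = f' (axis i 1)"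
  by (simp add: partial_deriv_def frechet_derivative_at[symmetric])

text \<open>Chain rule: the affine map has derivative \<open>M\<close> everywhere, and
  \<open>M\<close> sends the i-th basis vector to its i-th column, whose entries become the
  coefficients.\<close>

lemma
  fixes M :: "real ^ 2 ^ 2"
  assumes "f differentiable_on UNIV"
  shows differentiable_affine: "(\<lambda>r. f (M *v r + s)) differentiable_on UNIV"
    and partial_deriv_affine: "partial_deriv i (\<lambda>r. f (M *v r + s)) =
      (\<lambda>r. \<Sum>j\<in>UNIV. M $ j $ i * partial_deriv j f (M *v r + s))"
proof -
  have f: "f differentiable (at r)" for r
    using assms by (auto simp: differentiable_on_def)
  have "((\<lambda>r. M *v r + s) has_derivative (\<lambda>h. M *v h)) (at r)" for r
    by (auto intro!: derivative_eq_intros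
        bounded_linear.has_derivative[OF matrix_vector_mul_bounded_linear])
  from diff_chain_at[OF this has_derivative_partial_deriv[OF f]]
  have der: "((\<lambda>r. f (M *v r + s)) has_derivative
      (\<lambda>h. \<Sum>i\<in>UNIV. (M *v h) $ i * partial_deriv i f (M *v r + s))) (at r)" for r
    by (simp add: o_def)
  then show "(\<lambda>r. f (M *v r + s)) differentiable_on UNIV"
    by (auto simp: differentiable_on_def differentiable_def)
  show "partial_deriv i (\<lambda>r. f (M *v r + s)) =
      (\<lambda>r. \<Sum>j\<in>UNIV. M $ j $ i * partial_deriv j f (M *v r + s))"
    by (rule ext, subst partial_deriv_eqI[OF der])
      (simp add: matrix_vector_mul_component column_def matrix_vector_mult_basis)
qed

lemma partial_deriv_sum:
  assumes "\<And>j. j \<in> I \<Longrightarrow> (f j) differentiable_on UNIV"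
  shows "partial_deriv i (\<lambda>r. \<Sum>j\<in>I. c j * f j r) = (\<lambda>r. \<Sum>j\<in>I. c j * partial_deriv i (f j) r)"
proof
  fix r
  have "((\<lambda>r. \<Sum>j\<in>I. c j * f j r) has_derivative
      (\<lambda>h. \<Sum>j\<in>I. c j * frechet_derivative (f j) (at r) h)) (at r)"
    by (intro has_derivative_sum has_derivative_mult_right)
      (use assms in \<open>auto simp: differentiable_on_def frechet_derivative_works\<close>)
  then show "partial_deriv i (\<lambda>r. \<Sum>j\<in>I. c j * f j r) r = (\<Sum>j\<in>I. c j * partial_deriv i (f j) r)"
    using partial_deriv_eqI by (fastforce simp: partial_deriv_def)
qed

text \<open>The chain rule is applied twice. After the first application the partial derivative is a
  sum, with constant coefficients, of partial derivatives of \<open>f\<close> composed with the same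
  affine map, so the rule applies again to each summand.\<close>

lemma
  fixes M :: "real ^ 2 ^ 2"
  assumes f: "twice_cont_diff f"
  shows twice_cont_diff_affine: "twice_cont_diff (\<lambda>r. f (M *v r + s))"
    and hessian_affine: "hessian (\<lambda>r. f (M *v r + s)) r =
      transpose M ** hessian f (M *v r + s) ** M"
proof -
  let ?g = "\<lambda>r. f (M *v r + s)"
  have D: "f differentiable_on UNIV" "\<And>i. partial_deriv i f differentiable_on UNIV"
    and C: "\<And>i j. continuous_on UNIV (partial_deriv i (partial_deriv j f))"
    using f by (auto simp: twice_cont_diff_def)
  note d1 = partial_deriv_affine[OF D(1)]
  have d2: "partial_deriv i (partial_deriv j ?g) =
      (\<lambda>r. \<Sum>k\<in>UNIV. M $ k $ j * (\<Sum>l\<in>UNIV. M $ l $ i *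
        partial_deriv l (partial_deriv k f) (M *v r + s)))" for i j
    unfolding d1 by (subst partial_deriv_sum) (auto intro: differentiable_affine D
      simp: partial_deriv_affine[OF D(2)])
  have cont: "continuous_on UNIV (\<lambda>r. M *v r + s)"
    by (intro continuous_intros matrix_vector_mult_linear_continuous_on)
  show "twice_cont_diff ?g"
    unfolding twice_cont_diff_def
  proof (intro conjI allI)
    show "?g differentiable_on UNIV"
      by (rule differentiable_affine[OF D(1)])
    show "partial_deriv i ?g differentiable_on UNIV" for i
      unfolding d1 using differentiable_affine[OF D(2)]
      by (auto simp: differentiable_on_def intro!: differentiable_sum differentiable_mult)
    show "continuous_on UNIV (partial_deriv i (partial_deriv j ?g))" for i j
      unfolding d2 by (intro continuous_intros continuous_on_compose2[OF C cont]) auto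
  qed
  show "hessian ?g r = transpose M ** hessian f (M *v r + s) ** M"
    unfolding hessian_def d2
    by (simp add: vec_eq_iff matrix_matrix_mult_def transpose_def sum_2 algebra_simps)
qed

subsection \<open>Symmetry of the Hessian\<close>

text \<open>
  The left-hand side is symmetric in \<open>i\<close> and \<open>j\<close>, the right-hand side tends to the mixed derivative
  after division by \<open>h\<^sup>2\<close>: this is Schwarz's theorem.
\<close>

lemma mixed_difference:
  assumes f: "twice_cont_diff f" and h: "0 < h"
  shows "\<exists>x y. 0 < x \<and> x < h \<and> 0 < y \<and> y < h \<and>
    f (a + h *\<^sub>R axis i 1 + h *\<^sub>R axis j 1) - f (a + h *\<^sub>R axis i 1)
      - f (a + h *\<^sub>R axis j 1) + f a
    = h\<^sup>2 * partial_deriv j (partial_deriv i f) (a + x *\<^sub>R axis i 1 + y *\<^sub>R axis j 1)"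
proof -
  have along: "((\<lambda>t. g (b + t *\<^sub>R axis k 1)) has_real_derivative
      partial_deriv k g (b + t *\<^sub>R axis k 1)) (at t)"
    if "g differentiable_on UNIV" for g k b t
  proof -
    have g: "g differentiable (at (b + t *\<^sub>R axis k 1))"
      using that by (auto simp: differentiable_on_def)
    have "((\<lambda>t. b + t *\<^sub>R axis k 1) has_derivative (\<lambda>x. x *\<^sub>R axis k 1)) (at t)"
      by (auto intro!: derivative_eq_intros)
    from diff_chain_at[OF this has_derivative_partial_deriv[OF g]]
    have "((\<lambda>t. g (b + t *\<^sub>R axis k 1)) has_derivative
        (\<lambda>x. \<Sum>l\<in>UNIV. (x *\<^sub>R axis k 1) $ l * partial_deriv l g (b + t *\<^sub>R axis k 1))) (at t)"
      by (simp add: o_def)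
    moreover have "(\<Sum>l\<in>UNIV. (x *\<^sub>R axis k 1) $ l * partial_deriv l g (b + t *\<^sub>R axis k 1)) =
        partial_deriv k g (b + t *\<^sub>R axis k 1) * x" for x :: real
      using exhaust_2[of k] by (auto simp: sum_2 axis_def)
    ultimately show ?thesis
      by (simp add: has_field_derivative_def)
  qed
  have D: "f differentiable_on UNIV" "\<And>i. partial_deriv i f differentiable_on UNIV"
    using f by (auto simp: twice_cont_diff_def)
  \<comment> \<open>The second difference is the increment of \<open>\<phi>\<close> from 0 to
    \<open>h\<close>. The mean value theorem for \<open>\<phi>\<close> yields \<open>x\<close> and
    leaves a difference of first derivatives in direction \<open>j\<close>; a second use of it there
    yields \<open>y\<close>.\<close>
  define \<phi> where "\<phi> t = f ((a + h *\<^sub>R axis j 1) + t *\<^sub>R axis i 1) - f (a + t *\<^sub>R axis i 1)" for t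
  have "(\<phi> has_real_derivative partial_deriv i f ((a + h *\<^sub>R axis j 1) + t *\<^sub>R axis i 1)
      - partial_deriv i f (a + t *\<^sub>R axis i 1)) (at t)" for t
    unfolding \<phi>_def by (intro DERIV_diff along D)
  from MVT2[OF h, of \<phi>, OF this] obtain x where x: "0 < x" "x < h" and
    \<phi>: "\<phi> h - \<phi> 0 = h * (partial_deriv i f ((a + h *\<^sub>R axis j 1) + x *\<^sub>R axis i 1)
      - partial_deriv i f (a + x *\<^sub>R axis i 1))"
    by auto
  from MVT2[OF h, of "\<lambda>t. partial_deriv i f ((a + x *\<^sub>R axis i 1) + t *\<^sub>R axis j 1)",
      OF along[OF D(2)]] obtain y where y: "0 < y" "y < h" and
    \<psi>: "partial_deriv i f ((a + x *\<^sub>R axis i 1) + h *\<^sub>R axis j 1) - partial_deriv i f (a + x *\<^sub>R axis i 1)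
      = h * partial_deriv j (partial_deriv i f) (a + x *\<^sub>R axis i 1 + y *\<^sub>R axis j 1)"
    by auto
  have "\<phi> h - \<phi> 0 = h\<^sup>2 * partial_deriv j (partial_deriv i f) (a + x *\<^sub>R axis i 1 + y *\<^sub>R axis j 1)"
    using \<phi> \<psi> by (simp add: power2_eq_square algebra_simps)
  moreover have "\<phi> h - \<phi> 0 = f (a + h *\<^sub>R axis i 1 + h *\<^sub>R axis j 1) - f (a + h *\<^sub>R axis i 1)
      - f (a + h *\<^sub>R axis j 1) + f a"
    by (simp add: \<phi>_def algebra_simps)
  ultimately show ?thesis
    using x y by metis
qed

lemma partial_deriv_commute:
  assumes f: "twice_cont_diff f"
  shows "partial_deriv i (partial_deriv j f) a = partial_deriv j (partial_deriv i f) a"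
proof -
  define e where "e n = inverse (real (Suc n))" for n
  have e: "e n > 0" for n
    by (simp add: e_def)
  \<comment> \<open>The step sizes \<open>e n\<close> tend to 0 and squeeze the intermediate points
    towards \<open>a\<close>, where the second derivatives are continuous.\<close>
  have lim: "(\<lambda>n. partial_deriv l (partial_deriv k f) (a + x n *\<^sub>R axis k 1 + y n *\<^sub>R axis l 1))
      \<longlonglongrightarrow> partial_deriv l (partial_deriv k f) a"
    if xy: "\<And>n. 0 < x n \<and> x n < e n \<and> 0 < y n \<and> y n < e n" for k l x y
  proof -
    have e0: "e \<longlonglongrightarrow> 0"
      unfolding e_def by (rule LIMSEQ_inverse_real_of_nat)
    have "x \<longlonglongrightarrow> 0" "y \<longlonglongrightarrow> 0"
      using xy by (auto intro!: tendsto_sandwich[OF _ _ tendsto_const e0] eventuallyI less_imp_le)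
    then have "(\<lambda>n. a + x n *\<^sub>R axis k 1 + y n *\<^sub>R axis l 1) \<longlonglongrightarrow> a + 0 *\<^sub>R axis k 1 + 0 *\<^sub>R axis l 1"
      by (intro tendsto_intros)
    moreover have "isCont (partial_deriv l (partial_deriv k f)) a"
      using f by (auto simp: twice_cont_diff_def continuous_on_eq_continuous_at)
    ultimately show ?thesis
      using isCont_tendsto_compose by fastforce
  qed
  obtain x y where xy: "\<And>n. 0 < x n \<and> x n < e n \<and> 0 < y n \<and> y n < e n"
    and 1: "\<And>n. f (a + e n *\<^sub>R axis i 1 + e n *\<^sub>R axis j 1) - f (a + e n *\<^sub>R axis i 1)
      - f (a + e n *\<^sub>R axis j 1) + f a
      = (e n)\<^sup>2 * partial_deriv j (partial_deriv i f) (a + x n *\<^sub>R axis i 1 + y n *\<^sub>R axis j 1)"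
    using mixed_difference[OF f e, where a = a and i = i and j = j] by metis
  obtain x' y' where xy': "\<And>n. 0 < x' n \<and> x' n < e n \<and> 0 < y' n \<and> y' n < e n"
    and 2: "\<And>n. f (a + e n *\<^sub>R axis j 1 + e n *\<^sub>R axis i 1) - f (a + e n *\<^sub>R axis j 1)
      - f (a + e n *\<^sub>R axis i 1) + f a
      = (e n)\<^sup>2 * partial_deriv i (partial_deriv j f) (a + x' n *\<^sub>R axis j 1 + y' n *\<^sub>R axis i 1)"
    using mixed_difference[OF f e, where a = a and i = j and j = i] by metis
  \<comment> \<open>Exchanging \<open>i\<close> and \<open>j\<close> only reorders the terms of the
    second difference; the positive square of \<open>e n\<close> cancels.\<close>
  have eq: "partial_deriv j (partial_deriv i f) (a + x n *\<^sub>R axis i 1 + y n *\<^sub>R axis j 1) =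
      partial_deriv i (partial_deriv j f) (a + x' n *\<^sub>R axis j 1 + y' n *\<^sub>R axis i 1)" for n
  proof -
    have "(e n)\<^sup>2 * partial_deriv j (partial_deriv i f) (a + x n *\<^sub>R axis i 1 + y n *\<^sub>R axis j 1) =
        (e n)\<^sup>2 * partial_deriv i (partial_deriv j f) (a + x' n *\<^sub>R axis j 1 + y' n *\<^sub>R axis i 1)"
      using 1[of n] 2[of n] by (simp add: algebra_simps)
    then show ?thesis
      using e[of n] by simp
  qed
  show ?thesis
    by (rule LIMSEQ_unique[OF lim[OF xy', where k = j and l = i]
        lim[OF xy, where k = i and l = j, unfolded eq]])
qed

lemma transpose_hessian: "twice_cont_diff f \<Longrightarrow> transpose (hessian f r) = hessian f r"
  by (simp add: transpose_def hessian_def vec_eq_iff partial_deriv_commute)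

section \<open>Quadratic forms as test images\<close>

lemma symmetric_entry:
  assumes "transpose A = A"
  shows "A $ i $ j = A $ j $ i"
  using arg_cong[OF assms, of "\<lambda>B. B $ j $ i"] by (simp add: transpose_def)

text \<open>The product rule gives two terms, equal because \<open>S\<close> is self-adjoint, and
  the factor 1/2 compensates for them: the gradient is \<open>S *v r\<close>. Together with
  \<open>transpose_hessian\<close> this identifies the symmetric matrices with the Hessians of
  admissible images, which serves both directions of the theorem.\<close>

lemma quadratic_form:
  assumes S: "transpose S = S"
  shows "twice_cont_diff (\<lambda>r. (r \<bullet> (S *v r)) / 2)" (is "twice_cont_diff ?q")
    and "hessian (\<lambda>r. (r \<bullet> (S *v r)) / 2) r = S"
proof -
  have self_adj: "(S *v x) \<bullet> y = x \<bullet> (S *v y)" for x y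
  proof -
    have "x v* S = S *v x"
      using transpose_matrix_vector[of S x] unfolding S by (rule sym)
    then show ?thesis
      using dot_lmul_matrix[of x S y] by (simp only:)
  qed
  have lin: "((*v) S has_derivative (*v) S) (at r)" for r
    by (rule bounded_linear_imp_has_derivative[OF matrix_vector_mul_bounded_linear])
  have q: "(?q has_derivative (\<lambda>h. h \<bullet> (S *v r))) (at r)" for r
  proof -
    have "(?q has_derivative (\<lambda>h. (r \<bullet> (S *v h) + h \<bullet> (S *v r)) / 2)) (at r)"
      by (intro bounded_linear.has_derivative[OF bounded_linear_divide]
          has_derivative_inner has_derivative_ident lin)
    moreover have "(r \<bullet> (S *v h) + h \<bullet> (S *v r)) / 2 = h \<bullet> (S *v r)" for h
    proof -
      have "r \<bullet> (S *v h) = h \<bullet> (S *v r)"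
        by (rule trans[OF self_adj[symmetric] inner_commute])
      then show ?thesis
        by simp
    qed
    ultimately show ?thesis
      by simp
  qed
  have pq: "partial_deriv j ?q = (\<lambda>r. (S *v r) $ j)" for j
    by (rule ext, subst partial_deriv_eqI[OF q]) (simp add: inner_axis')
  have comp: "((\<lambda>r. (S *v r) $ j) has_derivative (\<lambda>h. (S *v h) $ j)) (at r)" for j r
    by (rule bounded_linear.has_derivative[OF bounded_linear_vec_nth lin])
  have ppq: "partial_deriv i (partial_deriv j ?q) = (\<lambda>r. S $ j $ i)" for i j
    unfolding pq by (rule ext, subst partial_deriv_eqI[OF comp])
      (simp add: matrix_vector_mult_basis column_def)
  show "twice_cont_diff ?q"
    unfolding twice_cont_diff_def ppq unfolding pq
    by (intro conjI allI continuous_on_const differentiable_at_imp_differentiable_on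
        differentiableI[OF q] differentiableI[OF comp])
  have "S $ j $ i = S $ i $ j" for i j
    using S by (rule symmetric_entry)
  then show "hessian ?q r = S"
    by (simp add: hessian_def ppq vec_eq_iff)
qed

subsection \<open>Eigenvalues and Schatten norms of symmetric matrices\<close>

text \<open>Orthogonality fixes multiples of the identity under conjugation, so
  \<open>mat x - A\<close> is conjugated as a whole, and the determinant is multiplicative.\<close>

lemma det_mat_minus_conj:
  fixes A R :: "real ^ 'n ^ 'n"
  assumes "orthogonal_matrix R"
  shows "det (mat x - transpose R ** A ** R) = det (mat x - A)"
proof -
  have R: "transpose R ** R = mat 1"
    using assms by (simp add: orthogonal_matrix_def)
  have "mat x = x *\<^sub>R (mat 1 :: real ^ 'n ^ 'n)"
    by (simp add: mat_def vec_eq_iff)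
  moreover have "transpose R ** (x *\<^sub>R mat 1) ** R = x *\<^sub>R (transpose R ** R)"
    by (simp add: scalar_matrix_assoc matrix_scalar_ac)
  ultimately have "transpose R ** mat x ** R = mat x"
    by (simp add: R)
  then have "mat x - transpose R ** A ** R = transpose R ** (mat x - A) ** R"
    by (simp add: matrix_matrix_mult_def vec_eq_iff left_diff_distrib right_diff_distrib
        sum_subtractf)
  then have "det (mat x - transpose R ** A ** R) = det (transpose R ** R) * det (mat x - A)"
    by (simp add: det_mul)
  then show ?thesis
    by (simp add: R)
qed

text \<open>The characteristic polynomials coincide, so both sides are the same definite
  description, even where no real eigenvalues exist.\<close>

lemma eigenvalues_conj:
  "orthogonal_matrix R \<Longrightarrow> eigenvalues (transpose R ** A ** R) = eigenvalues A"
  by (simp add: eigenvalues_def det_mat_minus_conj)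

text \<open>As \<open>R ** transpose R\<close> cancels in the middle, the Gram matrix
  \<open>transpose A ** A\<close> is itself conjugated by \<open>R\<close>, and its eigenvalues do
  not change.\<close>

lemma schatten_norm_conj:
  assumes R: "orthogonal_matrix R"
  shows "schatten_norm p (transpose R ** A ** R) = schatten_norm p A"
proof -
  have "transpose (transpose R ** A ** R) ** (transpose R ** A ** R) =
      transpose R ** (transpose A ** ((R ** transpose R) ** A)) ** R"
    by (simp add: matrix_transpose_mul matrix_mul_assoc)
  also have "\<dots> = transpose R ** (transpose A ** A) ** R"
    using R by (simp add: orthogonal_matrix_def)
  finally show ?thesis
    using R by (simp add: schatten_norm_def singular_values_def eigenvalues_conj)
qed

lemma transpose_conj:
  fixes A M :: "real ^ 'n ^ 'n"
  assumes "transpose A = A"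
  shows "transpose (transpose M ** A ** M) = transpose M ** A ** M"
  using assms by (simp add: matrix_transpose_mul matrix_mul_assoc)

section \<open>Scaling of eigenvalues and diagonalization by rotations\<close>

definition diag :: "real ^ 2 \<Rightarrow> real ^ 2 ^ 2" where
  "diag l = (\<chi> i j. if i = j then l $ i else 0)"

lemma diag_scaleR: "diag (c *\<^sub>R l) = c *\<^sub>R diag l"
  by (simp add: diag_def vec_eq_iff)

lemma transpose_diag [simp]: "transpose (diag l) = diag l"
  by (auto simp: diag_def vec_eq_iff transpose_def)

lemma det_mat_minus_diag: "det (mat x - diag l) = (x - l $ 1) * (x - l $ 2)"
  by (simp add: det_2 mat_def diag_def)

lemma transpose_scaleR: "transpose (c *\<^sub>R A) = c *\<^sub>R transpose (A :: real ^ 'n ^ 'm)"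
  by (simp add: transpose_def vec_eq_iff)

text \<open>The characteristic polynomial of \<open>c *\<^sub>R A\<close> at \<open>x\<close> is c^2
  times that of \<open>A\<close> at \<open>x / c\<close>. Positivity of \<open>c\<close> preserves
  the decreasing order of the roots.\<close>

lemma eigenvalues_scaleR:
  assumes A: "transpose A = A" and c: "c > 0"
  shows "eigenvalues (c *\<^sub>R A) = c *\<^sub>R eigenvalues A"
proof (rule eigenvalues_eqI)
  show "(c *\<^sub>R eigenvalues A) $ 2 \<le> (c *\<^sub>R eigenvalues A) $ 1"
    using eigenvalues_symmetric(1)[OF A] c by simp
  fix x
  have "mat x - c *\<^sub>R A = c *\<^sub>R (mat (x / c) - A)"
    using c by (auto simp: mat_def vec_eq_iff right_diff_distrib)
  then have "det (mat x - c *\<^sub>R A) = c\<^sup>2 * det (mat (x / c) - A)"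
    by (simp add: det_2 power2_eq_square algebra_simps)
  also have "\<dots> = (c * (x / c - eigenvalues A $ 1)) * (c * (x / c - eigenvalues A $ 2))"
    by (simp add: eigenvalues_symmetric(2)[OF A] power2_eq_square)
  also have "\<dots> = (x - (c *\<^sub>R eigenvalues A) $ 1) * (x - (c *\<^sub>R eigenvalues A) $ 2)"
    using c by (simp add: right_diff_distrib)
  finally show "det (mat x - c *\<^sub>R A) = (x - (c *\<^sub>R eigenvalues A) $ 1) * (x - (c *\<^sub>R eigenvalues A) $ 2)" .
qed

text \<open>A unit eigenvector for the first eigenvalue becomes the first column of a rotation. In
  the rotated basis the first column of the matrix is then diagonal, symmetry clears the other
  off-diagonal entry, and the characteristic polynomial determines the last one. A rotation, and not
  merely an orthogonal matrix, is produced because the invariance of the potential is available for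
  rotations.\<close>

lemma diagonalization:
  assumes A: "transpose A = A"
  obtains R where "rotation_matrix R" "transpose R ** A ** R = diag (eigenvalues A)"
proof -
  let ?l = "eigenvalues A"
  have "det (mat (?l $ 1) - A) = 0"
    by (simp add: eigenvalues_symmetric(2)[OF A])
  then obtain w where w: "w \<noteq> 0" "(mat (?l $ 1) - A) *v w = 0"
    using matrix_left_invertible_ker[of "mat (?l $ 1) - A"]
    by (metis invertible_det_nz invertible_left_inverse)
  define v where "v = w /\<^sub>R norm w"
  have "norm v = 1"
    using w by (simp add: v_def)
  then obtain R where R: "rotation_matrix R" "R *v axis 1 1 = v"
    using rotation_matrix_exists_basis[of v 1] by auto
  have orth: "orthogonal_matrix R"
    using R by (simp add: rotation_matrix_def)
  have "(mat (?l $ 1) - A) *v v = 0"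
    using w by (simp add: v_def matrix_vector_mult_scaleR)
  moreover have "mat (?l $ 1) *v v = ?l $ 1 *\<^sub>R v"
    by (simp add: vec_eq_iff matrix_vector_mult_def mat_def if_distrib[of "\<lambda>z. z * _"] cong: if_cong)
  ultimately have Av: "A *v v = ?l $ 1 *\<^sub>R v"
    by (simp add: matrix_vector_mult_diff_rdistrib)
  define B where "B = transpose R ** A ** R"
  have sym: "B $ 2 $ 1 = B $ 1 $ 2"
    unfolding B_def by (rule symmetric_entry[OF transpose_conj[OF A]])
  have "transpose R *v v = axis 1 1"
    using orth unfolding R(2)[symmetric]
    by (simp add: matrix_vector_mul_assoc orthogonal_matrix_def)
  then have "B *v axis 1 1 = ?l $ 1 *\<^sub>R axis 1 1"
    by (simp add: B_def R(2) Av matrix_vector_mult_scaleR flip: matrix_vector_mul_assoc)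
  then have col: "column 1 B = ?l $ 1 *\<^sub>R axis 1 1"
    by (simp add: matrix_vector_mult_basis)
  have B1: "B $ 1 $ 1 = ?l $ 1" "B $ 2 $ 1 = 0"
    using arg_cong[OF col, of "\<lambda>v. v $ 1"] arg_cong[OF col, of "\<lambda>v. v $ 2"]
    by (simp_all add: column_def axis_def)
  have "det (mat x - B) = (x - ?l $ 1) * (x - ?l $ 2)" for x
    using orth by (simp add: B_def det_mat_minus_conj eigenvalues_symmetric(2)[OF A])
  \<comment> \<open>At this \<open>x\<close> the factor belonging to the first eigenvalue equals 1,
    so the identity is linear in the remaining entry.\<close>
  from this[of "?l $ 1 + 1"] have "B $ 2 $ 2 = ?l $ 2"
    using B1 sym by (simp add: det_2 mat_def)
  then have "B = diag ?l"
    using B1 sym by (simp add: diag_def vec_eq_iff forall_2)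
  then show ?thesis
    using R that unfolding B_def by blast
qed

section \<open>The l_p norms and the Schatten norms of symmetric matrices\<close>

lemma lp_norm_scaleR:
  fixes x :: "real ^ 'n"
  assumes c: "c \<ge> 0" and p: "1 \<le> p"
  shows "lp_norm p (c *\<^sub>R x) = c * lp_norm p x"
proof (cases "p = \<infinity>")
  case True
  then show ?thesis
    using c by (simp add: lp_norm_def infnorm_mul)
next
  case False
  define q where "q = real_of_ereal p"
  have q: "q \<ge> 1"
    using p False unfolding q_def by (cases p) auto
  have "(\<Sum>i\<in>UNIV. \<bar>(c *\<^sub>R x) $ i\<bar> powr q) = c powr q * (\<Sum>i\<in>UNIV. \<bar>x $ i\<bar> powr q)"
    using c by (simp add: abs_mult powr_mult sum_distrib_left)
  then show ?thesis
    using False c q by (simp add: lp_norm_def q_def[symmetric] powr_mult sum_nonneg powr_powr)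
qed

lemma lp_norm_nonneg: "0 \<le> lp_norm p x"
  by (simp add: lp_norm_def infnorm_pos_le)

lemma lp_norm_eq_0_iff:
  fixes x :: "real ^ 'n"
  assumes p: "1 \<le> p"
  shows "lp_norm p x = 0 \<longleftrightarrow> x = 0"
  using p by (cases "p = \<infinity>")
    (auto simp: lp_norm_def infnorm_eq_0 sum_nonneg_eq_0_iff vec_eq_iff)

lemma lp_norm_normalized:
  assumes p: "1 \<le> p" and x: "x \<noteq> 0"
  shows "lp_norm p (x /\<^sub>R lp_norm p x) = 1"
  using lp_norm_eq_0_iff[OF p, of x] lp_norm_nonneg[of p x] x
  by (subst lp_norm_scaleR[OF _ p]) auto

text \<open>The singular values are the absolute values of the entries of \<open>l\<close>, but
  \<open>eigenvalues\<close> sorts their squares in decreasing order. The two cases are the two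
  possible orders; the l_p norm sees neither order nor signs.\<close>

lemma schatten_norm_diag: "schatten_norm p (diag l) = lp_norm p l"
proof -
  have sq: "diag l ** diag l = diag (\<chi> i. (l $ i)\<^sup>2)"
    by (simp add: diag_def matrix_matrix_mult_def vec_eq_iff sum_2 forall_2 power2_eq_square)
  show ?thesis
  proof (cases "(l $ 2)\<^sup>2 \<le> (l $ 1)\<^sup>2")
    case True
    then have "eigenvalues (diag (\<chi> i. (l $ i)\<^sup>2)) = (\<chi> i. (l $ i)\<^sup>2)"
      by (intro eigenvalues_eqI) (simp_all add: det_mat_minus_diag)
    then have "singular_values (diag l) = (\<chi> i. \<bar>l $ i\<bar>)"
      by (simp add: singular_values_def sq)
    then show ?thesis
      by (simp add: schatten_norm_def lp_norm_def sum_2 infnorm_2)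
  next
    case False
    then have "eigenvalues (diag (\<chi> i. (l $ i)\<^sup>2)) = vector [(l $ 2)\<^sup>2, (l $ 1)\<^sup>2]"
      by (intro eigenvalues_eqI) (simp_all add: det_mat_minus_diag)
    then have "singular_values (diag l) = vector [\<bar>l $ 2\<bar>, \<bar>l $ 1\<bar>]"
      by (simp add: singular_values_def sq vec_eq_iff forall_2)
    then show ?thesis
      by (simp add: schatten_norm_def lp_norm_def sum_2 infnorm_2 add.commute max.commute)
  qed
qed

lemma schatten_norm_symmetric:
  assumes "transpose A = A"
  shows "schatten_norm p A = lp_norm p (eigenvalues A)"
proof -
  obtain R where "rotation_matrix R" "transpose R ** A ** R = diag (eigenvalues A)"
    using diagonalization[OF assms] .
  then show ?thesis
    by (metis rotation_matrix_def schatten_norm_conj schatten_norm_diag)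
qed

lemma schatten_norm_scaleR:
  assumes "transpose A = A" "c > 0" "1 \<le> p"
  shows "schatten_norm p (c *\<^sub>R A) = c * schatten_norm p A"
  using assms by (simp add: schatten_norm_symmetric transpose_scaleR eigenvalues_scaleR lp_norm_scaleR)

lemma rpow_mult: "c > 0 \<Longrightarrow> x \<ge> 0 \<Longrightarrow> rpow (c * x) \<nu> = c powr \<nu> * rpow x \<nu>"
  by (simp add: rpow_def powr_mult)

subsection \<open>Invariance of the functional and of the potential\<close>

text \<open>The maps \<open>h\<close> and \<open>T\<close> are mutually inverse, so the substitution
  of \<open>h r\<close> in the integral over the image domain evaluates the Hessian of the
  transformed image at the point where it is the conjugate of \<open>hessian f r\<close>. Both maps
  are variables tied to \<open>M\<close>, \<open>N\<close> and \<open>s\<close> by equations, which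
  lets each invariance be matched in the syntactic form of its definition.\<close>

lemma functional_affine:
  fixes M N :: "real ^ 2 ^ 2"
  assumes \<Omega>: "\<Omega> \<in> sets lebesgue" and f: "twice_cont_diff f"
    and MN: "M ** N = mat 1" and h: "\<And>r. h r = N *v (r - s)" and T: "\<And>r. T r = M *v r + s"
  shows "functional_defined \<Phi> (h ` \<Omega>) (\<lambda>r. f (T r)) \<longleftrightarrow>
      set_integrable lebesgue \<Omega> (\<lambda>r. \<Phi> (transpose M ** hessian f r ** M))" (is ?def)
    and "functional \<Phi> (h ` \<Omega>) (\<lambda>r. f (T r)) =
      \<bar>det N\<bar> * set_lebesgue_integral lebesgue \<Omega> (\<lambda>r. \<Phi> (transpose M ** hessian f r ** M))" (is ?int)
proof -
  have N: "invertible N"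
    using MN by (metis invertible_def matrix_left_right_inverse)
  have "M *v h r + s = r" for r
    by (simp add: h matrix_vector_mul_assoc MN)
  then have H: "\<Phi> (hessian (\<lambda>r. f (T r)) (h r)) = \<Phi> (transpose M ** hessian f r ** M)" for r
    by (simp add: T hessian_affine[OF f])
  show ?def ?int
    unfolding functional_defined_def functional_def
    using set_integral_affine_image[OF \<Omega> N h, where F = "\<lambda>r. \<Phi> (hessian (\<lambda>r. f (T r)) r)"]
    by (simp_all add: H)
qed

text \<open>Serves the converse direction for all three invariances: \<open>c\<close> is 1 for
  translations and rotations and a^(2 \<nu>) for dilations by \<open>a\<close>. A nonzero constant
  factor does not affect integrability.\<close>

lemma functional_covariant:
  fixes M N :: "real ^ 2 ^ 2"
  assumes \<Omega>: "\<Omega> \<in> sets lebesgue" and f: "twice_cont_diff f"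
    and MN: "M ** N = mat 1" "\<And>r. h r = N *v (r - s)" "\<And>r. T r = M *v r + s"
    and \<Phi>: "\<And>r. \<Phi> (transpose M ** hessian f r ** M) = c * \<Phi> (hessian f r)" and c: "c \<noteq> 0"
  shows "functional_defined \<Phi> (h ` \<Omega>) (\<lambda>r. f (T r)) \<longleftrightarrow> functional_defined \<Phi> \<Omega> f"
    and "functional \<Phi> (h ` \<Omega>) (\<lambda>r. f (T r)) = \<bar>det N\<bar> * c * functional \<Phi> \<Omega> f"
  unfolding functional_affine[OF \<Omega> f MN] \<Phi> using c
  by (simp_all add: functional_defined_def functional_def)

text \<open>The Hessian of the quadratic form is constant, hence so is the integrand, and a constant
  over a set of finite measure integrates to the measure times the constant.\<close>

lemma functional_quadratic_form:
  fixes M N :: "real ^ 2 ^ 2"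
  assumes \<Omega>: "\<Omega> \<in> lmeasurable" and A: "transpose A = A"
    and MN: "M ** N = mat 1" "\<And>r. h r = N *v (r - s)" "\<And>r. T r = M *v r + s"
  shows "functional \<Phi> (h ` \<Omega>) (\<lambda>r. (T r \<bullet> (A *v T r)) / 2) =
    \<bar>det N\<bar> * (measure lebesgue \<Omega> * \<Phi> (transpose M ** A ** M))"
proof -
  have \<Omega>': "\<Omega> \<in> sets lebesgue"
    using \<Omega> by (rule fmeasurableD)
  have "(LINT r:\<Omega>|lebesgue. c) = measure lebesgue \<Omega> * c" for c :: real
    using \<Omega> by (simp add: set_lebesgue_integral_def fmeasurable_def)
  then show ?thesis
    using functional_affine(2)[OF \<Omega>' quadratic_form(1)[OF A] MN] by (simp add: quadratic_form(2)[OF A])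
qed

lemma scaleR_mat_1_mult:
  fixes A :: "real ^ 2 ^ 2"
  shows "(a *\<^sub>R mat 1) *v r = a *\<^sub>R (r :: real ^ 2)"
    and "transpose (a *\<^sub>R mat 1) ** A ** (a *\<^sub>R mat 1) = a\<^sup>2 *\<^sub>R A"
    and "a \<noteq> 0 \<Longrightarrow> (a *\<^sub>R mat 1) ** (inverse a *\<^sub>R mat 1) = (mat 1 :: real ^ 2 ^ 2)"
    and "det (a *\<^sub>R mat 1 :: real ^ 2 ^ 2) = a\<^sup>2"
  by (simp_all add: vec_eq_iff forall_2 matrix_matrix_mult_def matrix_vector_mult_def transpose_def
      mat_def sum_2 det_2 power2_eq_square)

section \<open>Functional equations for the potential and its spectral form\<close>

text \<open>For the quadratic form of \<open>A\<close> both functionals are the area of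
  \<open>\<Omega>\<close> times a value of \<open>\<Phi>\<close>, since a rotation has determinant
  1; the positive area cancels.\<close>

lemma potential_rotation:
  assumes \<Omega>: "\<Omega> \<in> lmeasurable" "measure lebesgue \<Omega> > 0"
    and inv: "rotation_invariant \<Phi> \<Omega>" and A: "transpose A = A" and R: "rotation_matrix R"
  shows "\<Phi> (transpose R ** A ** R) = \<Phi> A"
proof -
  let ?q = "\<lambda>r. (r \<bullet> (A *v r)) / 2"
  have RR: "R ** transpose R = mat 1" "det (transpose R) = 1"
    using R by (auto simp: rotation_matrix_def orthogonal_matrix_def)
  have "functional \<Phi> ((\<lambda>r. transpose R *v r) ` \<Omega>) (\<lambda>r. ?q (R *v r)) = functional \<Phi> \<Omega> ?q"
    using inv quadratic_form(1)[OF A] R unfolding rotation_invariant_def by blast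
  moreover have "functional \<Phi> ((\<lambda>r. transpose R *v r) ` \<Omega>) (\<lambda>r. ?q (R *v r)) =
      measure lebesgue \<Omega> * \<Phi> (transpose R ** A ** R)"
    using functional_quadratic_form[OF \<Omega>(1) A RR(1), of "\<lambda>r. transpose R *v r" 0 "\<lambda>r. R *v r"] RR(2)
    by simp
  moreover have "functional \<Phi> \<Omega> ?q = measure lebesgue \<Omega> * \<Phi> A"
    using functional_quadratic_form[OF \<Omega>(1) A, of "mat 1" "mat 1" "\<lambda>r. r" 0 "\<lambda>r. r"] by simp
  ultimately show ?thesis
    using \<Omega>(2) by simp
qed

text \<open>For the quadratic form of \<open>A\<close> and a dilation by \<open>a\<close>, the
  invariance reads a^(-2) \<open>\<Phi>\<close> (a^2 A) = a^\<mu> \<open>\<Phi> A\<close> once the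
  positive area of \<open>\<Omega>\<close> is cancelled.\<close>

lemma potential_scaling:
  assumes \<Omega>: "\<Omega> \<in> lmeasurable" "measure lebesgue \<Omega> > 0"
    and inv: "scale_invariant \<Phi> \<Omega>"
  obtains \<nu> where "\<And>A c. transpose A = A \<Longrightarrow> c > 0 \<Longrightarrow> \<Phi> (c *\<^sub>R A) = c powr \<nu> * \<Phi> A"
proof -
  from inv obtain \<mu> where \<mu>: "functional \<Phi> ((\<lambda>r. r /\<^sub>R a) ` \<Omega>) (\<lambda>r. f (a *\<^sub>R r)) =
      a powr \<mu> * functional \<Phi> \<Omega> f" if "twice_cont_diff f" "a > 0" for f a
    unfolding scale_invariant_def by blast
  have "\<Phi> (c *\<^sub>R A) = c powr ((\<mu> + 2) / 2) * \<Phi> A" if A: "transpose A = A" and c: "c > 0" for A c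
  proof -
    let ?q = "\<lambda>r. (r \<bullet> (A *v r)) / 2"
    \<comment> \<open>A dilation by \<open>a\<close> multiplies the Hessian by a^2, so the factor
      \<open>c\<close> calls for its square root.\<close>
    define a where "a = sqrt c"
    have a: "a > 0" "a\<^sup>2 = c"
      using c by (simp_all add: a_def)
    have "functional \<Phi> ((\<lambda>r. r /\<^sub>R a) ` \<Omega>) (\<lambda>r. ?q (a *\<^sub>R r)) =
        (inverse a)\<^sup>2 * (measure lebesgue \<Omega> * \<Phi> (c *\<^sub>R A))"
      using functional_quadratic_form[OF \<Omega>(1) A scaleR_mat_1_mult(3), of a "\<lambda>r. r /\<^sub>R a" 0 "\<lambda>r. a *\<^sub>R r"] a
      by (simp add: scaleR_mat_1_mult)
    moreover have "functional \<Phi> \<Omega> ?q = measure lebesgue \<Omega> * \<Phi> A"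
      using functional_quadratic_form[OF \<Omega>(1) A, of "mat 1" "mat 1" "\<lambda>r. r" 0 "\<lambda>r. r"] by simp
    ultimately have "(inverse a)\<^sup>2 * (measure lebesgue \<Omega> * \<Phi> (c *\<^sub>R A)) =
        a powr \<mu> * (measure lebesgue \<Omega> * \<Phi> A)"
      using \<mu>[OF quadratic_form(1)[OF A] a(1)] by simp
    then have "\<Phi> (c *\<^sub>R A) = a powr \<mu> * a\<^sup>2 * \<Phi> A"
      using \<Omega>(2) a(1) by (simp add: field_simps)
    also have "a powr \<mu> * a\<^sup>2 = a powr (\<mu> + 2)"
      using a(1) by (simp add: powr_add)
    also have "\<dots> = c powr ((\<mu> + 2) / 2)"
      using c by (simp add: a_def powr_half_sqrt[symmetric] powr_powr)
    finally show ?thesis .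
  qed
  then show ?thesis
    by (rule that)
qed

text \<open>Rotation to diagonal form shows that \<open>\<Phi>\<close> depends only on the
  eigenvalue vector; homogeneity then extracts the norm of that vector to the power
  \<open>\<nu>\<close> and leaves a function of its direction.\<close>

lemma spectral_form_of_potential:
  assumes p: "1 \<le> p"
    and rot: "\<And>A R. transpose A = A \<Longrightarrow> rotation_matrix R \<Longrightarrow> \<Phi> (transpose R ** A ** R) = \<Phi> A"
    and scale: "\<And>A c. transpose A = A \<Longrightarrow> c > 0 \<Longrightarrow> \<Phi> (c *\<^sub>R A) = c powr \<nu> * \<Phi> A"
  obtains \<Phi>\<^sub>0 where "zero_degree_homogeneous \<Phi>\<^sub>0"
    "\<And>A. transpose A = A \<Longrightarrow>
      \<Phi> A = \<Phi>\<^sub>0 (eigenvalues A /\<^sub>R schatten_norm p A) * rpow (schatten_norm p A) \<nu>"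
proof
  \<comment> \<open>The argument is normalised once more inside \<open>\<Phi>\<^sub>0\<close>: this
    makes it zero-degree homogeneous on the whole plane and changes nothing on vectors of norm
    1.\<close>
  define \<Phi>\<^sub>0 where "\<Phi>\<^sub>0 x = \<Phi> (diag (x /\<^sub>R lp_norm p x))" for x
  show "zero_degree_homogeneous \<Phi>\<^sub>0"
    unfolding zero_degree_homogeneous_def
  proof (intro allI impI)
    fix t :: real and x :: "real ^ 2"
    assume "t > 0"
    then have "(t *\<^sub>R x) /\<^sub>R lp_norm p (t *\<^sub>R x) = x /\<^sub>R lp_norm p x"
      using p by (simp add: lp_norm_scaleR field_simps)
    then show "\<Phi>\<^sub>0 (t *\<^sub>R x) = \<Phi>\<^sub>0 x"
      unfolding \<Phi>\<^sub>0_def by (rule arg_cong)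
  qed
  fix A :: "real ^ 2 ^ 2"
  assume A: "transpose A = A"
  define l where "l = eigenvalues A"
  define n where "n = lp_norm p l"
  have n: "schatten_norm p A = n"
    by (simp add: n_def l_def schatten_norm_symmetric[OF A])
  have \<Phi>A: "\<Phi> A = \<Phi> (diag l)"
    using diagonalization[OF A] rot[OF A] by (metis l_def)
  show "\<Phi> A = \<Phi>\<^sub>0 (eigenvalues A /\<^sub>R schatten_norm p A) * rpow (schatten_norm p A) \<nu>"
  proof (cases "l = 0")
    case True
    have n0: "n = 0"
      using lp_norm_eq_0_iff[OF p, of l] True by (simp add: n_def)
    have d0: "diag 0 = 0"
      by (simp add: diag_def vec_eq_iff)
    \<comment> \<open>The zero matrix is fixed by every scaling, so the factor 2 already forces
      \<open>\<nu> = 0\<close> or \<open>\<Phi> 0 = 0\<close>. In the first case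
      \<open>rpow 0 0 = 1\<close> and \<open>\<Phi>\<^sub>0 0 = \<Phi> 0\<close>; in the second both
      sides vanish.\<close>
    have "\<Phi> 0 = 2 powr \<nu> * \<Phi> 0"
      using scale[of 0 2] by (simp add: transpose_def vec_eq_iff)
    then have "\<nu> = 0 \<or> \<Phi> 0 = 0"
      by auto
    then show ?thesis
      using True n0 d0 \<Phi>A by (auto simp: n l_def[symmetric] \<Phi>\<^sub>0_def rpow_def)
  next
    case False
    then have pos: "n > 0"
      using lp_norm_eq_0_iff[OF p, of l] lp_norm_nonneg[of p l] by (simp add: n_def)
    have "\<Phi> (diag l) = \<Phi> (n *\<^sub>R diag (l /\<^sub>R n))"
      using pos by (simp flip: diag_scaleR)
    also have "\<dots> = n powr \<nu> * \<Phi> (diag (l /\<^sub>R n))"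
      using pos by (intro scale) simp_all
    also have "\<Phi> (diag (l /\<^sub>R n)) = \<Phi>\<^sub>0 (l /\<^sub>R n)"
      using lp_norm_normalized[OF p False] by (simp add: \<Phi>\<^sub>0_def n_def)
    finally show ?thesis
      using pos by (simp add: \<Phi>A n l_def[symmetric] rpow_def)
  qed
qed

theorem theorem2:
  fixes \<Phi> :: "real ^ 2 ^ 2 \<Rightarrow> real" and \<Omega> :: "(real ^ 2) set" and p :: ereal
  assumes "\<Omega> \<in> lmeasurable" and "measure lebesgue \<Omega> > 0" and "p \<ge> 1"
  shows "(translation_invariant \<Phi> \<Omega> \<and> rotation_invariant \<Phi> \<Omega> \<and> scale_invariant \<Phi> \<Omega>) \<longleftrightarrow>
    (\<exists>(\<nu>::real) \<Phi>\<^sub>0. zero_degree_homogeneous \<Phi>\<^sub>0 \<and>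
      (\<forall>f r. twice_cont_diff f \<longrightarrow>
        \<Phi> (hessian f r) =
          \<Phi>\<^sub>0 (eigenvalues (hessian f r) /\<^sub>R schatten_norm p (hessian f r)) *
          rpow (schatten_norm p (hessian f r)) \<nu>))"
proof (intro iffI; elim conjE exE)
  assume rot: "rotation_invariant \<Phi> \<Omega>" and scale: "scale_invariant \<Phi> \<Omega>"
  obtain \<nu> where "\<And>A c. transpose A = A \<Longrightarrow> c > 0 \<Longrightarrow> \<Phi> (c *\<^sub>R A) = c powr \<nu> * \<Phi> A"
    using potential_scaling[OF assms(1,2) scale] by metis
  from spectral_form_of_potential[OF assms(3) potential_rotation[OF assms(1,2) rot] this]
  obtain \<Phi>\<^sub>0 where "zero_degree_homogeneous \<Phi>\<^sub>0" "\<And>A. transpose A = A \<Longrightarrow>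
      \<Phi> A = \<Phi>\<^sub>0 (eigenvalues A /\<^sub>R schatten_norm p A) * rpow (schatten_norm p A) \<nu>"
    by metis
  then show "\<exists>\<nu> \<Phi>\<^sub>0. zero_degree_homogeneous \<Phi>\<^sub>0 \<and> (\<forall>f r. twice_cont_diff f \<longrightarrow>
      \<Phi> (hessian f r) = \<Phi>\<^sub>0 (eigenvalues (hessian f r) /\<^sub>R schatten_norm p (hessian f r)) *
        rpow (schatten_norm p (hessian f r)) \<nu>)"
    using transpose_hessian by blast
next
  fix \<nu> \<Phi>\<^sub>0
  assume form: "\<forall>f r. twice_cont_diff f \<longrightarrow>
      \<Phi> (hessian f r) = \<Phi>\<^sub>0 (eigenvalues (hessian f r) /\<^sub>R schatten_norm p (hessian f r)) *
        rpow (schatten_norm p (hessian f r)) \<nu>"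
  \<comment> \<open>The quadratic form of \<open>A\<close> turns the hypothesis on images into an
    identity on symmetric matrices, which can then be used at a conjugated Hessian as well.\<close>
  have \<Phi>: "\<Phi> A = \<Phi>\<^sub>0 (eigenvalues A /\<^sub>R schatten_norm p A) * rpow (schatten_norm p A) \<nu>"
    if "transpose A = A" for A
    using form quadratic_form[OF that] by metis
  have \<Omega>: "\<Omega> \<in> sets lebesgue"
    using assms(1) by (rule fmeasurableD)
  have "translation_invariant \<Phi> \<Omega>"
    unfolding translation_invariant_def
  proof (intro allI impI)
    fix f :: "real ^ 2 \<Rightarrow> real" and s :: "real ^ 2"
    assume f: "twice_cont_diff f"
    show "(functional_defined \<Phi> ((\<lambda>r. r - s) ` \<Omega>) (\<lambda>r. f (r + s)) \<longleftrightarrow> functional_defined \<Phi> \<Omega> f) \<and>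
        functional \<Phi> ((\<lambda>r. r - s) ` \<Omega>) (\<lambda>r. f (r + s)) = functional \<Phi> \<Omega> f"
      using functional_covariant[OF \<Omega> f, where M = "mat 1" and N = "mat 1" and s = s and c = 1
          and h = "\<lambda>r. r - s" and T = "\<lambda>r. r + s" and \<Phi> = \<Phi>]
      by simp
  qed
  moreover have "rotation_invariant \<Phi> \<Omega>"
    unfolding rotation_invariant_def
  proof (intro allI impI)
    fix f :: "real ^ 2 \<Rightarrow> real" and R :: "real ^ 2 ^ 2"
    assume f: "twice_cont_diff f" and R: "rotation_matrix R"
    then have orth: "orthogonal_matrix R" and det: "det R = 1"
      by (simp_all add: rotation_matrix_def)
    have "\<Phi> (transpose R ** hessian f r ** R) = \<Phi> (hessian f r)" for r
      using transpose_hessian[OF f, of r] orth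
      by (simp add: \<Phi> transpose_conj eigenvalues_conj schatten_norm_conj)
    then show "(functional_defined \<Phi> ((\<lambda>r. transpose R *v r) ` \<Omega>) (\<lambda>r. f (R *v r)) \<longleftrightarrow>
          functional_defined \<Phi> \<Omega> f) \<and>
        functional \<Phi> ((\<lambda>r. transpose R *v r) ` \<Omega>) (\<lambda>r. f (R *v r)) = functional \<Phi> \<Omega> f"
      using functional_covariant[OF \<Omega> f, where M = R and N = "transpose R" and s = 0 and c = 1
          and h = "\<lambda>r. transpose R *v r" and T = "\<lambda>r. R *v r" and \<Phi> = \<Phi>] orth det
      by (simp add: orthogonal_matrix_def)
  qed
  moreover have "scale_invariant \<Phi> \<Omega>"
    unfolding scale_invariant_def
  \<comment> \<open>The Hessian grows by a^2 and contributes a^(2 \<nu>), while the area of the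
    domain shrinks by a^(-2).\<close>
  proof (intro exI[of _ "2 * \<nu> - 2"] allI impI)
    fix f :: "real ^ 2 \<Rightarrow> real" and a :: real
    assume f: "twice_cont_diff f" and a: "a > 0"
    have "\<Phi> (a\<^sup>2 *\<^sub>R hessian f r) = (a\<^sup>2) powr \<nu> * \<Phi> (hessian f r)" for r
    proof -
      let ?H = "hessian f r"
      have H: "transpose ?H = ?H"
        using f by (rule transpose_hessian)
      have S: "schatten_norm p (a\<^sup>2 *\<^sub>R ?H) = a\<^sup>2 * schatten_norm p ?H"
        and "eigenvalues (a\<^sup>2 *\<^sub>R ?H) = a\<^sup>2 *\<^sub>R eigenvalues ?H"
        using a by (simp_all add: schatten_norm_scaleR[OF H] eigenvalues_scaleR[OF H] assms(3))
      \<comment> \<open>Eigenvalues and norm carry the same factor, so their quotient is unchanged;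
        at a zero Hessian both quotients are 0.\<close>
      then have "eigenvalues (a\<^sup>2 *\<^sub>R ?H) /\<^sub>R schatten_norm p (a\<^sup>2 *\<^sub>R ?H) =
          eigenvalues ?H /\<^sub>R schatten_norm p ?H"
        using a by simp
      moreover have "schatten_norm p ?H \<ge> 0"
        by (simp add: schatten_norm_def lp_norm_nonneg)
      ultimately show ?thesis
        using a by (simp add: \<Phi> H transpose_scaleR S rpow_mult)
    qed
    then have "(functional_defined \<Phi> ((\<lambda>r. r /\<^sub>R a) ` \<Omega>) (\<lambda>r. f (a *\<^sub>R r)) \<longleftrightarrow> functional_defined \<Phi> \<Omega> f) \<and>
        functional \<Phi> ((\<lambda>r. r /\<^sub>R a) ` \<Omega>) (\<lambda>r. f (a *\<^sub>R r)) =
          \<bar>(inverse a)\<^sup>2\<bar> * (a\<^sup>2) powr \<nu> * functional \<Phi> \<Omega> f"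
      using functional_covariant[OF \<Omega> f, where M = "a *\<^sub>R mat 1" and N = "inverse a *\<^sub>R mat 1" and s = 0
          and c = "(a\<^sup>2) powr \<nu>" and h = "\<lambda>r. r /\<^sub>R a" and T = "\<lambda>r. a *\<^sub>R r" and \<Phi> = \<Phi>] a
      by (simp add: scaleR_mat_1_mult)
    moreover have "\<bar>(inverse a)\<^sup>2\<bar> * (a\<^sup>2) powr \<nu> = a powr (2 * \<nu> - 2)"
    proof -
      have "(a\<^sup>2) powr \<nu> = a powr (2 * \<nu>)"
        using a by (simp flip: powr_numeral add: powr_powr)
      then show ?thesis
        using a by (simp add: powr_diff field_simps)
    qed
    ultimately show "(functional_defined \<Phi> ((\<lambda>r. r /\<^sub>R a) ` \<Omega>) (\<lambda>r. f (a *\<^sub>R r)) \<longleftrightarrow>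
          functional_defined \<Phi> \<Omega> f) \<and>
        functional \<Phi> ((\<lambda>r. r /\<^sub>R a) ` \<Omega>) (\<lambda>r. f (a *\<^sub>R r)) = a powr (2 * \<nu> - 2) * functional \<Phi> \<Omega> f"
      by simp
  qed
  ultimately show "translation_invariant \<Phi> \<Omega> \<and> rotation_invariant \<Phi> \<Omega> \<and> scale_invariant \<Phi> \<Omega>"
    by blast
qed

end
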